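(* Let $m,n,p$ be positive integers. There are at least two typical ranks of $m\times n\times p$ tensors over $\mathbb{R}$ in each of the following cases. (1) $3\le m\le \rho(n)$ and $(m-1)(n-1)+1\le p\le (m-1)n$, where $\rho$ is the Hurwitz-Radon function. (2) $m=3$, $n\equiv 3\pmod 4$ and $p=2n-1$. (3) $m=4$, $n\equiv 2\pmod 4$, $n\ge 6$ and $p=3n-2$. (4) $m=6$, $n\equiv 4\pmod 8$, $n\ge 12$ and $p=5n-4$. (5) $m=10$, $n\equiv 24\pmod{32}$ and $p=9n-8$.
   Context: An $m\times n\times p$ tensor over $\mathbb{R}$ is an array $T=(a_{ijk})_{1\le i\le m,1\le j\le n,1\le k\le p}$ with real entries, identified with $\sum_{i,j,k}a_{ijk}\,\mathbf e_i\otimes \mathbf e_j\otimes \mathbf e_k\in\mathbb{R}^m\otimes\mathbb{R}^n\otimes\mathbb{R}^p$. The set of all of them is denoted $\mathbb{R}^{m\times n\times p}$. The rank of $T$ (over $\mathbb{R}$) is the smallest $r$ such that $T=\sum_{i=1}^r \mathbf a_i\otimes \mathbf b_i\otimes \mathbf c_i$ for some $\mathbf a_i\in\mathbb{R}^m$, $\mathbf b_i\in\mathbb{R}^n$, $\mathbf c_i\in\mathbb{R}^p$. An integer $r$ is a typical rank of $m\times n\times p$ tensors over $\mathbb{R}$ if there is a subset $S\subset\mathbb{R}^{m\times n\times p}$ of positive Lebesgue measure such that $\operatorname{rank} T=r$ for every $T\in S$. Hurwitz-Radon function: for a positive integer $n$, write $n=(2a+1)2^{b+4c}$ with (nonnegative)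 integers $a,b,c$ and $0\le b<4$; then $\rho(n)=8c+2^b$. *)

theory Defs
  imports "HOL-Analysis.Analysis"
begin

text \<open>The entry \<open>a\<^sub>i\<^sub>j\<^sub>k\<close> of an \<open>m \<times> n \<times> p\<close> tensor \<open>T\<close> is \<open>T $ i $ j $ k\<close>. The dimensions are
  the cardinalities of the index types. The Euclidean structure on this type identifies it with
  \<open>\<real>\<close> to the power \<open>mnp\<close>, so \<open>lebesgue\<close> on it is Lebesgue measure on the space of arrays.\<close>

type_synonym ('m, 'n, 'p) tensor = "((real ^ 'p) ^ 'n) ^ 'm"

definition tensor_product ::
  "real ^ 'm \<Rightarrow> real ^ 'n \<Rightarrow> real ^ 'p \<Rightarrow> ('m::finite, 'n::finite, 'p::finite) tensor" where
  "tensor_product a b c = (\<chi> i j k. a $ i * b $ j * c $ k)"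

definition has_decomposition ::
  "('m::finite, 'n::finite, 'p::finite) tensor \<Rightarrow> nat \<Rightarrow> bool" where
  "has_decomposition T r \<longleftrightarrow>
     (\<exists>(a :: nat \<Rightarrow> real ^ 'm) (b :: nat \<Rightarrow> real ^ 'n) (c :: nat \<Rightarrow> real ^ 'p).
        T = (\<Sum>i<r. tensor_product (a i) (b i) (c i)))"

definition tensor_rank :: "('m::finite, 'n::finite, 'p::finite) tensor \<Rightarrow> nat" where
  "tensor_rank T = (LEAST r. has_decomposition T r)"

definition typical_rank ::
  "'m::finite itself \<Rightarrow> 'n::finite itself \<Rightarrow> 'p::finite itself \<Rightarrow> nat \<Rightarrow> bool" where
  "typical_rank _ _ _ r \<longleftrightarrow>
     (\<exists>S :: ('m, 'n, 'p) tensor set.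
        S \<in> sets lebesgue \<and> emeasure lebesgue S > 0 \<and> (\<forall>T\<in>S. tensor_rank T = r))"

definition hurwitz_radon :: "nat \<Rightarrow> nat" where
  "hurwitz_radon n =
     (THE r. \<exists>a b c. n = (2 * a + 1) * 2 ^ (b + 4 * c) \<and> b < 4 \<and> r = 8 * c + 2 ^ b)"

text \<open>Every tensor has a decomposition, so the minimum defining the rank is attained.\<close>

lemma has_decomposition_exists:
  fixes T :: "('m::finite, 'n::finite, 'p::finite) tensor"
  shows "\<exists>r. has_decomposition T r"
proof -
  define A where "A = (UNIV :: ('m \<times> 'n \<times> 'p) set)"
  define f where "f = (\<lambda>(i, j, k). tensor_product (axis i (T $ i $ j $ k))
      (axis j 1) (axis k 1) :: ('m, 'n, 'p) tensor)"
  have "finite A" by (simp add: A_def)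
  then obtain h where h: "bij_betw h {0..<card A} A"
    using ex_bij_betw_nat_finite by blast
  have T: "T = sum f A"
  proof -
    have "sum f A $ x $ y $ z = T $ x $ y $ z" for x y z
    proof -
      have "sum f A $ x $ y $ z = (\<Sum>w\<in>A. f w $ x $ y $ z)"
        by (simp add: sum_component)
      also have "\<dots> = (\<Sum>w\<in>A. if w = (x, y, z) then T $ x $ y $ z else 0)"
        by (rule sum.cong) (auto simp: f_def tensor_product_def axis_def split: if_splits)
      also have "\<dots> = T $ x $ y $ z"
        using \<open>finite A\<close> by (simp add: A_def)
      finally show ?thesis .
    qed
    then show ?thesis by (simp add: vec_eq_iff)
  qed
  also have "\<dots> = (\<Sum>l<card A. f (h l))"
    using sum.reindex_bij_betw[OF h, of f] by (simp add: atLeast0LessThan)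
  finally have "T = (\<Sum>l<card A. tensor_product
      ((\<lambda>(i, j, k). axis i (T $ i $ j $ k)) (h l))
      ((\<lambda>(i, j, k). axis j 1) (h l)) ((\<lambda>(i, j, k). axis k 1) (h l)))"
    by (simp add: f_def case_prod_beta)
  then show ?thesis unfolding has_decomposition_def
    by (intro exI[of _ "card A"]
        exI[of _ "\<lambda>l. (\<lambda>(i, j, k). axis i (T $ i $ j $ k)) (h l)"]
        exI[of _ "\<lambda>l. (\<lambda>(i, j, k). axis j 1) (h l)"]
        exI[of _ "\<lambda>l. (\<lambda>(i, j, k). axis k 1) (h l)"])
qed

lemma has_decomposition_tensor_rank: "has_decomposition T (tensor_rank T)"
  unfolding tensor_rank_def using has_decomposition_exists by (rule LeastI_ex)

lemma odd_times_power_2_unique: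
  assumes "(2 * a + 1) * 2 ^ k = (2 * a' + 1) * (2::nat) ^ k'"
  shows "k = k'"
proof -
  have *: "multiplicity 2 ((2 * a + 1) * 2 ^ k) = k" for a k :: nat
  proof (rule multiplicity_eqI)
    show "\<not> 2 ^ Suc k dvd (2 * a + 1) * 2 ^ k"
      using dvd_times_right_cancel_iff[of "2 ^ k :: nat" 2 "2 * a + 1"] by simp
  qed simp
  show ?thesis using *[of a k] *[of a' k'] assms by metis
qed

text \<open>The exponent, hence the pair \<open>(b, c)\<close>, is determined by \<open>n\<close>, so the description is proper.\<close>

lemma hurwitz_radon_eq:
  assumes "b < 4"
  shows "hurwitz_radon ((2 * a + 1) * 2 ^ (b + 4 * c)) = 8 * c + 2 ^ b"
  unfolding hurwitz_radon_def
proof (rule the_equality)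
  fix r
  assume "\<exists>a' b' c'. (2 * a + 1) * 2 ^ (b + 4 * c) = (2 * a' + 1) * 2 ^ (b' + 4 * c')
    \<and> b' < 4 \<and> r = 8 * c' + 2 ^ b'"
  then obtain a' b' c' where
    e: "(2 * a + 1) * 2 ^ (b + 4 * c) = (2 * a' + 1) * (2::nat) ^ (b' + 4 * c')"
    and r: "b' < 4" "r = 8 * c' + 2 ^ b'" by blast
  have "b + 4 * c = b' + 4 * c'" using odd_times_power_2_unique[OF e] .
  then have "c = c'" "b = b'" using assms r(1) by presburger+
  then show "r = 8 * c + 2 ^ b" using r(2) by simp
qed (use assms in blast)

end

theory Submission imports Defs begin

text \<open>Put \<open>u = m n - p\<close>. In all five cases there is a nonsingular bilinear map from
  \<open>\<real>\<^sup>m \<times> \<real>\<^sup>n\<close> to \<open>\<real>\<^sup>u\<close>, obtained by restriction from a Hurwitz-Radon family. A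
  \<open>p\<close>-dimensional space of matrices orthogonal to its \<open>u\<close> coefficient matrices contains no matrix
  of rank one, and a tensor whose slices span such a space has rank greater than \<open>p\<close>. This persists
  in a neighbourhood by compactness. On the other hand, since \<open>p \<ge> (m - 1)(n - 1) + 1\<close>, the map
  \<open>(a, b, c) \<mapsto> \<Sum>\<^sub>l a\<^sub>l \<otimes> b\<^sub>l \<otimes> c\<^sub>l\<close> with \<open>p\<close> summands is a submersion at the point where
  \<open>c\<^sub>l = e\<^sub>l\<close> and \<open>a\<^sub>l\<close>, \<open>b\<^sub>l\<close> are the vectors of powers of \<open>t\<^sub>l\<close> and of \<open>t\<^sub>l\<close> to the power
  \<open>m - 1\<close>, for distinct positive \<open>t\<^sub>l\<close>. So the tensors of rank at most \<open>p\<close> have interior points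
  too. The sets of tensors of a given rank being measurable, every nonempty open set contains a
  tensor whose rank is typical.\<close>

section \<open>Hurwitz-Radon families\<close>

unbundle bit_operations_syntax

text \<open>The Hurwitz-Radon matrices are signed permutation matrices of \<open>{..<q * 2 ^ (b + 4 * c)}\<close>. The
  permutation of the \<open>i\<close>-th one is translation by \<open>hr_shift c i\<close> for the bitwise exclusive or, and
  \<open>hr_sign c i r\<close> says whether its entry in row \<open>r\<close> is negative. For \<open>c = 0\<close> these are the
  multiplications by octonion units, acting on blocks of eight coordinates. The step from \<open>c\<close> to
  \<open>Suc c\<close> splits a row into a bit \<open>r mod 16 \<ge> 8\<close>, an octonion index \<open>r mod 8\<close> and an old row
  \<open>r div 16\<close>: on the two halves given by the bit, an old matrix \<open>A\<close> acts diagonally as \<open>A\<close> and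
  its transpose, and an octonion unit \<open>E\<close> acts off the diagonal as \<open>E\<close> and minus its transpose.\<close>

definition octonion_sign :: "nat \<Rightarrow> nat \<Rightarrow> bool" where
  "octonion_sign i r \<longleftrightarrow> r \<in> set ([[], [0, 3, 5, 6], [0, 1, 6, 7], [0, 2, 5, 7],
     [0, 1, 2, 3], [0, 2, 4, 6], [0, 3, 4, 7], [0, 1, 4, 5]] ! i)"

text \<open>Rows \<open>r\<close> and \<open>r XOR i XOR j\<close> meet the same two columns with
  the roles of the two matrices exchanged. Opposite sign products there mean that the transpose of
  one unit times the other is skew-symmetric. With eight units this is a finite check.\<close>

lemma octonion_sign_anticommute:
  assumes "i < 8" "j < 8" "i \<noteq> j" "r < 8"
  shows "(octonion_sign i r = octonion_sign j r) \<noteq>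
    (octonion_sign i (r XOR i XOR j) = octonion_sign j (r XOR i XOR j))"
proof -
  have "\<forall>i\<in>set [0..<8]. \<forall>j\<in>set [0..<8]. \<forall>r\<in>set [0..<8]. i \<noteq> j
      \<longrightarrow> (octonion_sign i r = octonion_sign j r) \<noteq>
    (octonion_sign i (r XOR i XOR j) = octonion_sign j (r XOR i XOR j))"
    by code_simp
  then show ?thesis using assms by simp
qed

fun hr_shift :: "nat \<Rightarrow> nat \<Rightarrow> nat" where
  "hr_shift 0 i = i"
| "hr_shift (Suc c) i = (if i < 8 then 8 + i else 16 * hr_shift c (i - 8))"

fun hr_sign :: "nat \<Rightarrow> nat \<Rightarrow> nat \<Rightarrow> bool" where
  "hr_sign 0 i r = octonion_sign i (r mod 8)"
| "hr_sign (Suc c) i r =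
    (if i < 8 then (if r mod 16 < 8 then octonion_sign i (r mod 8)
       else \<not> octonion_sign i (r mod 8 XOR i))
     else (if r mod 16 < 8 then hr_sign c (i - 8) (r div 16)
       else hr_sign c (i - 8) (r div 16 XOR hr_shift c (i - 8))))"

section \<open>Bitwise exclusive or on row indices\<close>

lemma xor_div_power_2: "((a::nat) XOR b) div 2 ^ k = (a div 2 ^ k) XOR (b div 2 ^ k)"
  by (metis drop_bit_eq_div drop_bit_xor)

lemma xor_mod_power_2: "((a::nat) XOR b) mod 2 ^ k = (a mod 2 ^ k) XOR (b mod 2 ^ k)"
  by (metis take_bit_eq_mod take_bit_xor)

text \<open>Only the lowest \<open>k\<close> bits of \<open>r\<close> can change, so translations by
  numbers below \<open>2 ^ k\<close> permute the rows.\<close>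

lemma xor_less_multiple:
  assumes "r < q * 2 ^ k" "g < (2::nat) ^ k"
  shows "r XOR g < q * 2 ^ k"
proof -
  have "(r XOR g) div 2 ^ k = r div 2 ^ k" using assms(2) by (simp add: xor_div_power_2)
  then show ?thesis using assms(1) by (metis div_less_iff_less_mult zero_less_numeral zero_less_power)
qed

lemma xor_less_8: "i < 8 \<Longrightarrow> j < 8 \<Longrightarrow> i XOR j < (8::nat)"
  using xor_less_multiple[of i 1 3 j] by simp

lemma xor_div_16: "((a::nat) XOR b) div 16 = (a div 16) XOR (b div 16)"
  using xor_div_power_2[of a b 4] by simp

lemma xor_mod_8: "((a::nat) XOR b) mod 8 = (a mod 8) XOR (b mod 8)"
  using xor_mod_power_2[of a b 3] by simp

lemma mod_16_less_8_iff: "(r::nat) mod 16 < 8 \<longleftrightarrow> even (r div 8)"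
  by presburger

lemma xor_mod_16_less_8: "((a::nat) XOR b) mod 16 < 8 \<longleftrightarrow> (a mod 16 < 8 \<longleftrightarrow> b mod 16 < 8)"
proof -
  have "(a XOR b) div 8 = (a div 8) XOR (b div 8)" using xor_div_power_2[of a b 3] by simp
  then show ?thesis unfolding mod_16_less_8_iff by (simp add: even_xor_iff)
qed

lemma xor_left_cancel: "(a::nat) XOR (a XOR b) = b"
  by (simp flip: xor.assoc)

lemma hr_shift_less: "i < 8 * c + 2 ^ b \<Longrightarrow> hr_shift c i < 2 ^ (b + 4 * c)"
proof (induction c arbitrary: i)
  case (Suc c)
  show ?case
  proof (cases "i < 8")
    case True
    have "(2::nat) ^ 4 \<le> 2 ^ (b + 4 * Suc c)" by (rule power_increasing) auto
    moreover have "hr_shift (Suc c) i < 2 ^ 4" using True by simp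
    ultimately show ?thesis by linarith
  next
    case False
    then have "hr_shift c (i - 8) < 2 ^ (b + 4 * c)" using Suc.prems by (intro Suc.IH) auto
    then show ?thesis using False by (simp add: power_add)
  qed
qed simp

text \<open>The rows with \<open>r mod 16 \<ge> 8\<close> carry transposes. So the octonion identity
  and the induction hypothesis are each used twice: at a row, and at its translate by the
  \<open>i\<close>-th shift, which yields the identity for the transposes. For an octonion unit
  against an old matrix, the minus sign before the transpose supplies the change of sign.\<close>

lemma hr_sign_anticommute:
  assumes "i < 8 * c + 8" "j < 8 * c + 8" "i \<noteq> j"
  shows "(hr_sign c i r = hr_sign c j r) \<noteq>
    (hr_sign c i (r XOR hr_shift c i XOR hr_shift c j)
        = hr_sign c j (r XOR hr_shift c i XOR hr_shift c j))"
  using assms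
proof (induction c arbitrary: i j r)
  case 0
  then show ?case using octonion_sign_anticommute[of i j "r mod 8"] by (simp add: xor_mod_8)
next
  case (Suc c)
  have less: "r mod 8 < 8" by simp
  have mod8: "(16 * x) mod 8 = 0" for x :: nat by presburger
  note simps = xor_div_16 xor_mod_8 xor_mod_16_less_8 mod8
  note xs = xor.assoc xor.commute xor.left_commute
  consider "i < 8" "j < 8" | "i < 8" "j \<ge> 8" | "i \<ge> 8" "j < 8" | "i \<ge> 8" "j \<ge> 8" by linarith
  then show ?case
  proof cases
    case 1
    have "(octonion_sign i (r mod 8) = octonion_sign j (r mod 8)) \<noteq>
      (octonion_sign i (r mod 8 XOR i XOR j) = octonion_sign j (r mod 8 XOR i XOR j))"
      using octonion_sign_anticommute 1 Suc.prems less by blast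
    moreover have "(octonion_sign i (r mod 8 XOR i) = octonion_sign j (r mod 8 XOR i)) \<noteq>
      (octonion_sign i (r mod 8 XOR j) = octonion_sign j (r mod 8 XOR j))"
      using octonion_sign_anticommute[of i j "r mod 8 XOR i"] 1 Suc.prems xor_less_8[OF less, of i]
      by (simp add: xs xor_left_cancel)
    ultimately show ?thesis using 1 by (auto simp: simps xs xor_left_cancel)
  next
    case 2
    then show ?thesis by (auto simp: simps xs xor_left_cancel)
  next
    case 3
    then show ?thesis by (auto simp: simps xs xor_left_cancel)
  next
    case 4
    define i' j' where ij: "i' = i - 8" "j' = j - 8"
    have lt: "i' < 8 * c + 8" "j' < 8 * c + 8" "i' \<noteq> j'" using 4 Suc.prems by (auto simp: ij)
    show ?thesis using 4 Suc.IH[OF lt, of "r div 16"] Suc.IH[OF lt, of "r div 16 XOR hr_shift c i'"]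
      by (auto simp: simps xs xor_left_cancel ij)
  qed
qed

definition hr_coeff :: "nat \<Rightarrow> nat \<Rightarrow> nat \<Rightarrow> real" where
  "hr_coeff c i r = (if hr_sign c i r then - 1 else 1)"

text \<open>Expanding the squares leaves the forms \<open>D i j\<close>. For \<open>i = j\<close>
  the signs square to 1 and the translation permutes the coordinates of \<open>y\<close>. For
  distinct \<open>i\<close>, \<open>j\<close>, the translation by \<open>?h\<close> exchanges the
  two factors \<open>y\<close> and reverses the sign, so \<open>D i j = - D i j\<close>.\<close>

lemma hr_norm_identity:
  fixes x y :: "nat \<Rightarrow> real"
  assumes "b \<le> 3" and n: "n = q * 2 ^ (b + 4 * c)" and k: "k = 8 * c + 2 ^ b"
  shows "(\<Sum>r<n. (\<Sum>i<k. x i * hr_coeff c i r * y (r XOR hr_shift c i))\<^sup>2)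
    = (\<Sum>i<k. (x i)\<^sup>2) * (\<Sum>r<n. (y r)\<^sup>2)"
proof -
  let ?g = "hr_shift c" and ?s = "hr_coeff c"
  have "(2::nat) ^ b \<le> 2 ^ 3" using assms(1) by (intro power_increasing) auto
  then have k8: "k \<le> 8 * c + 8" by (simp add: k)
  have shift: "r XOR ?g i < n" if "r < n" "i < k" for r i
    using xor_less_multiple hr_shift_less that unfolding n k by blast
  have bij: "bij_betw (\<lambda>r. r XOR g) {..<n} {..<n}" if "\<And>r. r < n \<Longrightarrow> r XOR g < n" for g
    by (rule bij_betw_byWitness[where f' = "\<lambda>r. r XOR g"]) (use that in \<open>auto simp: xor.assoc\<close>)
  define D where "D i j = (\<Sum>r<n. ?s i r * ?s j r * (y (r XOR ?g i) * y (r XOR ?g j)))" for i j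
  have diag: "D i i = (\<Sum>r<n. (y r)\<^sup>2)" if "i < k" for i
  proof -
    have "D i i = (\<Sum>r<n. (y (r XOR ?g i))\<^sup>2)"
      unfolding D_def by (rule sum.cong) (auto simp: hr_coeff_def power2_eq_square)
    also have "\<dots> = (\<Sum>r<n. (y r)\<^sup>2)"
      using sum.reindex_bij_betw[OF bij, of "?g i" "\<lambda>r. (y r)\<^sup>2"] shift that by simp
    finally show ?thesis .
  qed
  have off: "D i j = 0" if "i < k" "j < k" "i \<noteq> j" for i j
  proof -
    let ?h = "?g i XOR ?g j"
    have "D i j = (\<Sum>r<n. ?s i (r XOR ?h) * ?s j (r XOR ?h) *
        (y (r XOR ?h XOR ?g i) * y (r XOR ?h XOR ?g j)))"
      unfolding D_def
      using sum.reindex_bij_betw[OF bij, of ?h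
          "\<lambda>r. ?s i r * ?s j r * (y (r XOR ?g i) * y (r XOR ?g j))"]
        shift that by (simp flip: xor.assoc)
    also have "\<dots> = (\<Sum>r<n. - (?s i r * ?s j r * (y (r XOR ?g i) * y (r XOR ?g j))))"
    proof (rule sum.cong[OF refl])
      fix r
      have "?s i (r XOR ?h) * ?s j (r XOR ?h) = - (?s i r * ?s j r)"
        using hr_sign_anticommute[of i c j r] that k8
        by (auto simp: hr_coeff_def xor.assoc split: if_splits)
      moreover have "r XOR ?h XOR ?g i = r XOR ?g j" "r XOR ?h XOR ?g j = r XOR ?g i"
        by (simp_all add: xor.assoc xor.commute xor.left_commute xor_left_cancel)
      ultimately show "?s i (r XOR ?h) * ?s j (r XOR ?h) *
          (y (r XOR ?h XOR ?g i) * y (r XOR ?h XOR ?g j)) =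
          - (?s i r * ?s j r * (y (r XOR ?g i) * y (r XOR ?g j)))" by simp
    qed
    also have "\<dots> = - D i j" by (simp add: D_def sum_negf)
    finally show ?thesis by simp
  qed
  have "(\<Sum>r<n. (\<Sum>i<k. x i * ?s i r * y (r XOR ?g i))\<^sup>2) =
      (\<Sum>r<n. \<Sum>i<k. \<Sum>j<k. x i * x j * (?s i r * ?s j r * (y (r XOR ?g i) * y (r XOR ?g j))))"
    by (simp add: power2_eq_square sum_product mult_ac)
  also have "\<dots> = (\<Sum>i<k. \<Sum>r<n. \<Sum>j<k. x i * x j * (?s i r * ?s j r * (y (r XOR ?g i) * y (r XOR ?g j))))"
    by (rule sum.swap)
  also have "\<dots> = (\<Sum>i<k. \<Sum>j<k. x i * x j * D i j)"
    unfolding D_def sum_distrib_left by (rule sum.cong[OF refl], rule sum.swap)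
  also have "\<dots> = (\<Sum>i<k. \<Sum>j<k. if j = i then (x i)\<^sup>2 * (\<Sum>r<n. (y r)\<^sup>2) else 0)"
    by (intro sum.cong refl) (auto simp: diag off power2_eq_square)
  also have "\<dots> = (\<Sum>i<k. (x i)\<^sup>2 * (\<Sum>r<n. (y r)\<^sup>2))" by simp
  finally show ?thesis by (simp add: sum_distrib_right)
qed

text \<open>The dimensions are numbers rather than index types, so that they can be computed and
  decreased freely before index types enter.\<close>

definition nonsingular_pairing :: "nat \<Rightarrow> nat \<Rightarrow> nat \<Rightarrow> bool" where
  "nonsingular_pairing m n u \<longleftrightarrow> (\<exists>w :: nat \<Rightarrow> nat \<Rightarrow> nat \<Rightarrow> real. \<forall>x y.
     (\<forall>l<u. (\<Sum>i<m. \<Sum>j<n. w l i j * x i * y j) = 0) \<longrightarrow> (\<forall>i<m. x i = 0) \<or> (\<forall>j<n. y j = 0))"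

text \<open>Output \<open>l\<close> is row \<open>l\<close> of the combination of the Hurwitz-Radon
  matrices with coefficients \<open>x\<close>, applied to \<open>y\<close>. If all outputs vanish,
  the norm identity makes the product of the squared norms of \<open>x\<close> and \<open>y\<close>
  vanish.\<close>

lemma hurwitz_radon_pairing:
  assumes "b \<le> 3"
  shows "nonsingular_pairing (8 * c + 2 ^ b) (q * 2 ^ (b + 4 * c)) (q * 2 ^ (b + 4 * c))"
proof -
  define k where "k = 8 * c + 2 ^ b"
  define n where "n = q * 2 ^ (b + 4 * c)"
  define w where "w l i j = (if j = l XOR hr_shift c i then hr_coeff c i l else 0)" for l i j
  have "(\<forall>i<k. x i = 0) \<or> (\<forall>j<n. y j = 0)"
    if eq: "\<forall>l<n. (\<Sum>i<k. \<Sum>j<n. w l i j * x i * y j) = 0" for x y :: "nat \<Rightarrow> real"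
  proof -
    have "(\<Sum>i<k. x i * hr_coeff c i r * y (r XOR hr_shift c i)) = 0" if "r < n" for r
    proof -
      have "(\<Sum>j<n. w r i j * x i * y j) = x i * hr_coeff c i r * y (r XOR hr_shift c i)" if "i < k"
          for i
      proof -
        have lt: "r XOR hr_shift c i < n"
          using xor_less_multiple hr_shift_less that \<open>r < n\<close> unfolding n_def k_def by blast
        have "(\<Sum>j<n. w r i j * x i * y j)
            = (\<Sum>j<n. if j = r XOR hr_shift c i then x i * hr_coeff c i r * y
                (r XOR hr_shift c i) else 0)"
          by (rule sum.cong) (auto simp: w_def)
        then show ?thesis using lt by simp
      qed
      then have "(\<Sum>i<k. x i * hr_coeff c i r * y (r XOR hr_shift c i))
          = (\<Sum>i<k. \<Sum>j<n. w r i j * x i * y j)"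
        by (intro sum.cong) auto
      then show ?thesis using eq that by simp
    qed
    then have "(\<Sum>i<k. (x i)\<^sup>2) * (\<Sum>r<n. (y r)\<^sup>2) = 0"
      using hr_norm_identity[OF assms n_def k_def, of x y] by simp
    then show ?thesis by (auto simp: sum_nonneg_eq_0_iff)
  qed
  then show ?thesis unfolding nonsingular_pairing_def k_def[symmetric] n_def[symmetric] by blast
qed

text \<open>Vectors on fewer coordinates extend by zero, and more outputs only add equations. This
  reaches an \<open>n\<close> that is not itself divisible by the required power of two.\<close>

lemma nonsingular_pairing_mono:
  assumes "nonsingular_pairing m n u" "m' \<le> m" "n' \<le> n" "u \<le> u'"
  shows "nonsingular_pairing m' n' u'"
proof -
  obtain w :: "nat \<Rightarrow> nat \<Rightarrow> nat \<Rightarrow> real" where w: "\<And>x y. \<forall>l<u. (\<Sum>i<m. \<Sum>j<n. w l i j * x i * y j) = 0 \<Longrightarrow>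
      (\<forall>i<m. x i = 0) \<or> (\<forall>j<n. y j = 0)"
    using assms(1) unfolding nonsingular_pairing_def by blast
  have "(\<forall>i<m'. x i = 0) \<or> (\<forall>j<n'. y j = 0)"
    if eq: "\<forall>l<u'. (\<Sum>i<m'. \<Sum>j<n'. w l i j * x i * y j) = 0" for x y :: "nat \<Rightarrow> real"
  proof -
    let ?x = "\<lambda>i. if i < m' then x i else 0" and ?y = "\<lambda>j. if j < n' then y j else 0"
    have "(\<Sum>i<m. \<Sum>j<n. w l i j * ?x i * ?y j) = (\<Sum>i<m'. \<Sum>j<n'. w l i j * x i * y j)" for l
      using assms(2,3) by (intro sum.mono_neutral_cong_right) (auto intro!: sum.mono_neutral_cong_right)
    then have "(\<forall>i<m. ?x i = 0) \<or> (\<forall>j<n. ?y j = 0)" using eq assms(4) by (intro w) auto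
    then show ?thesis using assms(2,3) by (meson order_less_le_trans)
  qed
  then show ?thesis unfolding nonsingular_pairing_def by blast
qed

unbundle no bit_operations_syntax

section \<open>Tensors of rank greater than \<open>p\<close>\<close>

text \<open>By the \<open>2 \<times> 2\<close> minors: no nontrivial combination of the \<open>m \<times> n\<close> slices has rank at most one.
  In particular the slices are linearly independent.\<close>

definition avoids_rank_one :: "('m::finite, 'n::finite, 'p::finite) tensor \<Rightarrow> bool" where
  "avoids_rank_one T \<longleftrightarrow> (\<forall>d. d \<noteq> 0 \<longrightarrow> (\<exists>i i' j j'.
     (T $ i $ j \<bullet> d) * (T $ i' $ j' \<bullet> d) \<noteq> (T $ i $ j' \<bullet> d) * (T $ i' $ j \<bullet> d)))"

text \<open>Contracting with a vector \<open>d\<close> orthogonal to all \<open>c l\<close> but the last leaves a matrix of rank at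
  most one.\<close>

lemma avoids_rank_one_not_has_decomposition:
  fixes T :: "('m::finite, 'n::finite, 'p::finite) tensor"
  assumes T: "avoids_rank_one T" and r: "r \<le> CARD('p)"
  shows "\<not> has_decomposition T r"
proof
  assume "has_decomposition T r"
  then obtain a b c where abc: "T = (\<Sum>l<r. tensor_product (a l) (b l) (c l))"
    unfolding has_decomposition_def by blast
  have "dim (c ` {..<r - 1}) \<le> r - 1"
    by (rule order_trans[OF dim_le_card']) (auto intro: order_trans[OF card_image_le])
  \<comment> \<open>For \<open>r = 0\<close> truncated subtraction gives 0, and a nonzero
    \<open>d\<close> exists as well.\<close>
  moreover have "r - 1 < CARD('p)" using r by (cases r) auto
  ultimately have "dim (c ` {..<r - 1}) < DIM(real ^ 'p)" by simp
  then obtain d where d: "d \<noteq> 0" "\<And>y. y \<in> span (c ` {..<r - 1}) \<Longrightarrow> orthogonal d y"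
    using orthogonal_to_subspace_exists by blast
  have ortho: "c l \<bullet> d = 0" if "l < r - 1" for l
    using d(2)[of "c l"] that by (auto intro: span_base simp: orthogonal_def inner_commute)
  have "T $ i $ j \<bullet> d = (\<Sum>l<r. a l $ i * b l $ j * (c l \<bullet> d))" for i j
  proof -
    have "T $ i $ j = (\<Sum>l<r. (a l $ i * b l $ j) *\<^sub>R c l)"
      unfolding abc by (simp add: vec_eq_iff sum_component tensor_product_def)
    then show ?thesis by (simp add: inner_sum_left)
  qed
  moreover have "(\<Sum>l<r. a l $ i * b l $ j * (c l \<bullet> d)) =
      (if r = 0 then 0 else a (r - 1) $ i * b (r - 1) $ j * (c (r - 1) \<bullet> d))" for i j
    by (cases r) (simp_all add: ortho)
  ultimately have Td: "T $ i $ j \<bullet> d =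
      (if r = 0 then 0 else a (r - 1) $ i * b (r - 1) $ j * (c (r - 1) \<bullet> d))" for i j
    by metis
  have "(T $ i $ j \<bullet> d) * (T $ i' $ j' \<bullet> d) = (T $ i $ j' \<bullet> d) * (T $ i' $ j \<bullet> d)" for i i' j j'
    unfolding Td by simp
  then show False using T d(1) unfolding avoids_rank_one_def by blast
qed

text \<open>The minor conditions are homogeneous in \<open>d\<close>, so \<open>d\<close> may be
  normalized to the unit sphere. The complement is then the projection of a closed set along a
  compact factor, hence closed.\<close>

lemma open_avoids_rank_one: "open {T :: ('m::finite, 'n::finite, 'p::finite) tensor. avoids_rank_one T}"
proof -
  let ?M = "\<lambda>z i j. snd z $ i $ j \<bullet> fst z"
  define R where "R = {z :: (real ^ 'p) \<times> ('m, 'n, 'p) tensor.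
     \<forall>i i' j j'. ?M z i j * ?M z i' j' = ?M z i j' * ?M z i' j}"
  have "closed R"
    unfolding R_def by (intro closed_Collect_all closed_Collect_eq continuous_intros)
  then have "closed {T. \<exists>d. d \<in> sphere 0 1 \<and> (d, T) \<in> R}"
    by (intro closed_compact_projection) auto
  moreover have "{T. \<exists>d. d \<in> sphere 0 1 \<and> (d, T) \<in> R} = - {T. avoids_rank_one T}"
  proof (intro equalityI subsetI)
    fix T :: "('m, 'n, 'p) tensor" assume "T \<in> {T. \<exists>d. d \<in> sphere 0 1 \<and> (d, T) \<in> R}"
    then obtain d where "norm d = 1" "(d, T) \<in> R" by auto
    moreover from this(1) have "d \<noteq> 0" by auto
    ultimately show "T \<in> - {T. avoids_rank_one T}"
      unfolding avoids_rank_one_def R_def by auto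
  next
    fix T :: "('m, 'n, 'p) tensor" assume "T \<in> - {T. avoids_rank_one T}"
    then obtain d where d: "d \<noteq> 0" "\<And>i i' j j'.
        (T $ i $ j \<bullet> d) * (T $ i' $ j' \<bullet> d) = (T $ i $ j' \<bullet> d) * (T $ i' $ j \<bullet> d)"
      unfolding avoids_rank_one_def by blast
    have "((1 / norm d) *\<^sub>R d, T) \<in> R" using d(2) by (simp add: R_def mult_ac)
    moreover have "(1 / norm d) *\<^sub>R d \<in> sphere 0 1" using d(1) by simp
    ultimately show "T \<in> {T. \<exists>d. d \<in> sphere 0 1 \<and> (d, T) \<in> R}" by blast
  qed
  ultimately show ?thesis by (simp add: closed_def)
qed

section \<open>From nonsingular pairings to tensors that avoid rank one\<close>

lemma ex_bij_betw_CARD: "\<exists>f. bij_betw f (UNIV :: 'a::finite set) {..<CARD('a)}"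
  using ex_bij_betw_finite_nat[of "UNIV :: 'a set"] by (simp add: atLeast0LessThan)

lemma nonsingular_pairing_matrices:
  assumes "nonsingular_pairing CARD('m::finite) CARD('n::finite) u"
  shows "\<exists>W :: nat \<Rightarrow> real ^ 'n ^ 'm. \<forall>a b. (\<forall>l<u. (\<Sum>i\<in>UNIV. \<Sum>j\<in>UNIV. W l $ i $ j * a $ i * b $ j) = 0)
      \<longrightarrow> a = 0 \<or> b = 0"
proof -
  obtain w :: "nat \<Rightarrow> nat \<Rightarrow> nat \<Rightarrow> real" where w:
      "\<And>x y. \<forall>l<u. (\<Sum>i<CARD('m). \<Sum>j<CARD('n). w l i j * x i * y j) = 0 \<Longrightarrow>
      (\<forall>i<CARD('m). x i = 0) \<or> (\<forall>j<CARD('n). y j = 0)"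
    using assms unfolding nonsingular_pairing_def by blast
  obtain f :: "'m \<Rightarrow> nat" where f: "bij_betw f UNIV {..<CARD('m)}" using ex_bij_betw_CARD by blast
  obtain g :: "'n \<Rightarrow> nat" where g: "bij_betw g UNIV {..<CARD('n)}" using ex_bij_betw_CARD by blast
  define W :: "nat \<Rightarrow> real ^ 'n ^ 'm" where "W l = (\<chi> i j. w l (f i) (g j))" for l
  have "a = 0 \<or> b = 0" if eq: "\<forall>l<u. (\<Sum>i\<in>UNIV. \<Sum>j\<in>UNIV. W l $ i $ j * a $ i * b $ j) = 0" for a b
  proof -
    define x y where "x i = a $ inv f i" and "y j = b $ inv g j" for i j
    have inv: "inv f (f i) = i" "inv g (g j) = j" for i j
      using f g by (auto simp: bij_betw_def)
    have "(\<Sum>i<CARD('m). \<Sum>j<CARD('n). w l i j * x i * y j)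
        = (\<Sum>i\<in>UNIV. \<Sum>j\<in>UNIV. W l $ i $ j * a $ i * b $ j)" for l
      unfolding sum.reindex_bij_betw[OF f, symmetric] sum.reindex_bij_betw[OF g, symmetric]
      by (simp add: W_def x_def y_def inv)
    then have "(\<forall>i<CARD('m). x i = 0) \<or> (\<forall>j<CARD('n). y j = 0)" using eq by (intro w) simp
    moreover have "f i < CARD('m)" "g j < CARD('n)" for i j
      using f g by (auto simp: bij_betw_def)
    ultimately show ?thesis by (metis x_def y_def inv vec_eq_iff zero_index)
  qed
  then show ?thesis by blast
qed

lemma ex_independent_family:
  assumes "CARD('p::finite) \<le> dim V"
  shows "\<exists>e :: 'p \<Rightarrow> 'v::euclidean_space. range e \<subseteq> V \<and> (\<forall>d. (\<Sum>k\<in>UNIV. d k *\<^sub>R e k) = 0 \<longrightarrow> d = (\<lambda>_. 0))"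
proof -
  obtain B where B: "B \<subseteq> V" "independent B" "card B = dim V" using basis_exists by metis
  have "finite B" using B(2) by (rule independent_imp_finite)
  then obtain e :: "'p \<Rightarrow> 'v" where e: "inj e" "range e \<subseteq> B"
    using card_le_inj[of "UNIV :: 'p set" B] assms B(3) by auto
  have "d k = 0" if eq: "(\<Sum>k\<in>UNIV. d k *\<^sub>R e k) = 0" for d k
  proof -
    have "(\<Sum>v\<in>range e. d (inv e v) *\<^sub>R v) = (\<Sum>k\<in>UNIV. d k *\<^sub>R e k)"
      using e(1) by (simp add: sum.reindex)
    then have "d (inv e (e k)) = 0"
      using independentD[OF B(2), of "range e" "\<lambda>v. d (inv e v)" "e k"] e(2) eq by simp
    then show ?thesis using e(1) by simp
  qed
  then show ?thesis using e(2) B(1) by blast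
qed

text \<open>The slices are independent matrices orthogonal to every \<open>W l\<close>. A rank-one
  combination of them would be a nontrivial common zero \<open>(a, b)\<close> of the
  pairing.\<close>

lemma ex_avoids_rank_one:
  assumes pairing: "nonsingular_pairing CARD('m::finite) CARD('n::finite) u"
    and le: "CARD('p::finite) + u \<le> CARD('m) * CARD('n)"
  shows "\<exists>T :: ('m, 'n, 'p) tensor. avoids_rank_one T"
proof -
  obtain W :: "nat \<Rightarrow> real ^ 'n ^ 'm" where W:
      "\<And>a b. \<forall>l<u. (\<Sum>i\<in>UNIV. \<Sum>j\<in>UNIV. W l $ i $ j * a $ i * b $ j) = 0 \<Longrightarrow> a = 0 \<or> b = 0"
    using nonsingular_pairing_matrices[OF pairing] by blast
  define V where "V = {X \<in> UNIV. \<forall>Y\<in>span (W ` {..<u}). orthogonal Y X}"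
  have "subspace V" unfolding V_def
    by (auto simp: subspace_def orthogonal_def inner_right_distrib)
  have "dim (W ` {..<u}) \<le> u"
    by (rule order_trans[OF dim_le_card']) (auto intro: order_trans[OF card_image_le])
  moreover have "dim V + dim (span (W ` {..<u})) = dim (UNIV :: (real ^ 'n ^ 'm) set)"
    unfolding V_def by (rule dim_subspace_orthogonal_to_vectors) auto
  ultimately have "CARD('p) \<le> dim V" using le by (simp add: mult.commute)
  then obtain e :: "'p \<Rightarrow> real ^ 'n ^ 'm" where e: "range e \<subseteq> V"
    "\<And>d. (\<Sum>k\<in>UNIV. d k *\<^sub>R e k) = 0 \<Longrightarrow> d = (\<lambda>_. 0)" using ex_independent_family by metis
  define T :: "('m, 'n, 'p) tensor" where "T = (\<chi> i j k. e k $ i $ j)"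
  have "avoids_rank_one T" unfolding avoids_rank_one_def
  proof (intro allI impI, rule ccontr)
    fix d :: "real ^ 'p" assume "d \<noteq> 0"
      and *: "\<not> (\<exists>i i' j j'. (T $ i $ j \<bullet> d) * (T $ i' $ j' \<bullet> d) \<noteq> (T $ i $ j' \<bullet> d) * (T $ i' $ j \<bullet> d))"
    define X where "X = (\<Sum>k\<in>UNIV. d $ k *\<^sub>R e k)"
    have Td: "T $ i $ j \<bullet> d = X $ i $ j" for i j
      by (simp add: T_def X_def inner_vec_def sum_component mult.commute)
    have "X \<noteq> 0" using e(2)[of "\<lambda>k. d $ k"] \<open>d \<noteq> 0\<close> unfolding X_def by (metis vec_eq_iff zero_index)
    then obtain i0 j0 where nz: "X $ i0 $ j0 \<noteq> 0" by (metis vec_eq_iff zero_index)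
    \<comment> \<open>The column and the row through a nonzero entry, the column being normalized to
      1 there. The vanishing minors give the factorization of \<open>X\<close>.\<close>
    define a b where "a = (\<chi> i. X $ i $ j0 / X $ i0 $ j0)" and "b = (\<chi> j. X $ i0 $ j)"
    have Xab: "X $ i $ j = a $ i * b $ j" for i j
      using * nz by (auto simp: Td a_def b_def field_simps)
    have "X \<in> V" unfolding X_def using \<open>subspace V\<close> e(1)
      by (intro subspace_sum subspace_scale) auto
    then have "W l \<bullet> X = 0" if "l < u" for l
      using that by (auto simp: V_def orthogonal_def intro: span_base)
    then have "\<forall>l<u. (\<Sum>i\<in>UNIV. \<Sum>j\<in>UNIV. W l $ i $ j * a $ i * b $ j) = 0"
      by (simp add: inner_vec_def Xab mult.assoc)
    then have "a = 0 \<or> b = 0" by (rule W)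
    then show False using nz Xab[of i0 j0] by auto
  qed
  then show ?thesis by blast
qed

section \<open>An open set of tensors of rank at most \<open>p\<close>\<close>

lemma polyfun_coeffs_zero:
  fixes c :: "nat \<Rightarrow> real"
  assumes "N \<le> card A" "finite A" "\<And>x. x \<in> A \<Longrightarrow> (\<Sum>i<N. c i * x ^ i) = 0" "i < N"
  shows "c i = 0"
proof (rule ccontr)
  assume "c i \<noteq> 0"
  then have "finite {z. (\<Sum>i\<le>N - 1. c i * z ^ i) = 0} \<and> card {z. (\<Sum>i\<le>N - 1. c i * z ^ i) = 0} \<le> N - 1"
    using assms(4) by (intro polyfun_rootbound exI[of _ i]) auto
  moreover have "{..N - 1} = {..<N}" using assms(4) by auto
  moreover have "A \<subseteq> {z. (\<Sum>i<N. c i * z ^ i) = 0}" using assms(3) by blast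
  ultimately have "card A \<le> N - 1" using card_mono by (metis order_trans)
  then show False using assms(1,4) by simp
qed

text \<open>Used to list the monomials \<open>x ^ i * (x ^ k) ^ j\<close> by their exponent
  \<open>i + k * j\<close>.\<close>

lemma sum_lessThan_mult:
  fixes h :: "nat \<Rightarrow> nat \<Rightarrow> 'a::comm_monoid_add"
  shows "(\<Sum>q<k * l. h (q mod k) (q div k)) = (\<Sum>i<k. \<Sum>j<l. h i j)"
proof (cases "k = 0")
  case False
  have lt: "i + k * j < k * l" if "i < k" "j < l" for i j
  proof -
    have "i + k * j < k * (Suc j)" using that by simp
    also have "\<dots> \<le> k * l" using that by (intro mult_le_mono) auto
    finally show ?thesis .
  qed
  have "(\<Sum>q<k * l. h (q mod k) (q div k)) = (\<Sum>(i, j)\<in>{..<k} \<times> {..<l}. h i j)"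
    by (rule sum.reindex_bij_witness[where i = "\<lambda>(i, j). i + k * j" and j = "\<lambda>q. (q mod k, q div k)"])
      (use False lt in \<open>auto simp: less_mult_imp_div_less mult.commute\<close>)
  then show ?thesis by (simp add: sum.cartesian_product)
qed simp

text \<open>The conditions \<open>row\<close> and \<open>col\<close> make the polynomial \<open>w(x, y)\<close> divisible by
  \<open>(x - s) * (y - s ^ \<mu>)\<close>. On the curve \<open>y = x ^ \<mu>\<close> the monomials of the quotient become the
  distinct powers \<open>x ^ q\<close> with \<open>q < \<mu> * \<nu>\<close>.\<close>

lemma bivariate_polynomial_zero:
  fixes w :: "nat \<Rightarrow> nat \<Rightarrow> real"
  assumes "\<mu> > 0" and A: "finite A" "\<mu> * \<nu> + 1 \<le> card A" "\<And>t. t \<in> A \<Longrightarrow> t > 0" and "s \<in> A"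
    and row: "\<And>j. j \<le> \<nu> \<Longrightarrow> (\<Sum>i\<le>\<mu>. w i j * s ^ i) = 0"
    and col: "\<And>i. i \<le> \<mu> \<Longrightarrow> (\<Sum>j\<le>\<nu>. w i j * (s ^ \<mu>) ^ j) = 0"
    and pts: "\<And>t. t \<in> A \<Longrightarrow> (\<Sum>i\<le>\<mu>. \<Sum>j\<le>\<nu>. w i j * t ^ i * (t ^ \<mu>) ^ j) = 0"
    and "i \<le> \<mu>" "j \<le> \<nu>"
  shows "w i j = 0"
proof -
  define \<tau> where "\<tau> = s ^ \<mu>"
  have "\<exists>q. \<forall>j\<le>\<nu>. \<forall>x. (\<Sum>i\<le>\<mu>. w i j * x ^ i) = (x - s) * (\<Sum>i<\<mu>. q j i * x ^ i)"
    using polyfun_linear_factor_root[OF row] by metis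
  then obtain q where q: "\<And>j x. j \<le> \<nu> \<Longrightarrow> (\<Sum>i\<le>\<mu>. w i j * x ^ i) = (x - s) * (\<Sum>i<\<mu>. q j i * x ^ i)"
    by blast
  have w_q: "(\<Sum>i\<le>\<mu>. \<Sum>j\<le>\<nu>. w i j * x ^ i * y ^ j) = (x - s) * (\<Sum>i<\<mu>. (\<Sum>j\<le>\<nu>. q j i * y ^ j) * x ^ i)"
      for x y
  proof -
    have "(\<Sum>i\<le>\<mu>. \<Sum>j\<le>\<nu>. w i j * x ^ i * y ^ j) = (\<Sum>j\<le>\<nu>. (\<Sum>i\<le>\<mu>. w i j * x ^ i) * y ^ j)"
      by (subst sum.swap) (simp add: sum_distrib_right)
    also have "\<dots> = (\<Sum>j\<le>\<nu>. (x - s) * (\<Sum>i<\<mu>. q j i * x ^ i) * y ^ j)"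
      by (intro sum.cong) (auto simp: q)
    also have "\<dots> = (x - s) * (\<Sum>j\<le>\<nu>. \<Sum>i<\<mu>. q j i * y ^ j * x ^ i)"
      by (simp add: sum_distrib_left sum_distrib_right mult_ac)
    also have "(\<Sum>j\<le>\<nu>. \<Sum>i<\<mu>. q j i * y ^ j * x ^ i) = (\<Sum>i<\<mu>. (\<Sum>j\<le>\<nu>. q j i * y ^ j) * x ^ i)"
      by (subst sum.swap) (simp add: sum_distrib_right)
    finally show ?thesis .
  qed
  \<comment> \<open>The points \<open>s + 1 + real k\<close> serve as \<mu> values different from
    \<open>s\<close>, at which the factor \<open>x - s\<close> can be cancelled.\<close>
  have q0: "(\<Sum>j\<le>\<nu>. q j i * \<tau> ^ j) = 0" if "i < \<mu>" for i
  proof (rule polyfun_coeffs_zero[where A = "(\<lambda>k. s + 1 + real k) ` {..<\<mu>}" and N = \<mu>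
      and c = "\<lambda>i. \<Sum>j\<le>\<nu>. q j i * \<tau> ^ j" and i = i])
    show "\<mu> \<le> card ((\<lambda>k. s + 1 + real k) ` {..<\<mu>})" by (subst card_image) (auto simp: inj_on_def)
    fix x assume "x \<in> (\<lambda>k. s + 1 + real k) ` {..<\<mu>}"
    then have "x \<noteq> s" by auto
    moreover have "(\<Sum>i\<le>\<mu>. \<Sum>j\<le>\<nu>. w i j * x ^ i * \<tau> ^ j) = (\<Sum>i\<le>\<mu>. (\<Sum>j\<le>\<nu>. w i j * \<tau> ^ j) * x ^ i)"
      by (simp add: sum_distrib_left sum_distrib_right mult_ac)
    then have "(\<Sum>i\<le>\<mu>. \<Sum>j\<le>\<nu>. w i j * x ^ i * \<tau> ^ j) = 0" using col by (simp add: \<tau>_def)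
    ultimately show "(\<Sum>i<\<mu>. (\<Sum>j\<le>\<nu>. q j i * \<tau> ^ j) * x ^ i) = 0" unfolding w_q by simp
  qed (use that in auto)
  have "\<exists>r. \<forall>i<\<mu>. \<forall>y. (\<Sum>j\<le>\<nu>. q j i * y ^ j) = (y - \<tau>) * (\<Sum>j<\<nu>. r i j * y ^ j)"
    using polyfun_linear_factor_root[OF q0] by metis
  then obtain r where r: "\<And>i y. i < \<mu> \<Longrightarrow> (\<Sum>j\<le>\<nu>. q j i * y ^ j) = (y - \<tau>) * (\<Sum>j<\<nu>. r i j * y ^ j)"
    by blast
  have w_r: "(\<Sum>i\<le>\<mu>. \<Sum>j\<le>\<nu>. w i j * x ^ i * y ^ j)
      = (x - s) * (y - \<tau>) * (\<Sum>i<\<mu>. \<Sum>j<\<nu>. r i j * x ^ i * y ^ j)" for x y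
  proof -
    have "(\<Sum>i<\<mu>. (\<Sum>j\<le>\<nu>. q j i * y ^ j) * x ^ i) = (\<Sum>i<\<mu>. (y - \<tau>) * (\<Sum>j<\<nu>. r i j * y ^ j) * x ^ i)"
      by (intro sum.cong) (auto simp: r)
    also have "\<dots> = (y - \<tau>) * (\<Sum>i<\<mu>. \<Sum>j<\<nu>. r i j * x ^ i * y ^ j)"
      by (simp add: sum_distrib_left sum_distrib_right mult_ac)
    finally show ?thesis unfolding w_q by simp
  qed
  \<comment> \<open>Positivity makes the \<mu>-th power injective on \<open>A\<close>, so both
    linear factors are nonzero away from \<open>s\<close>. At least \<open>\<mu> * \<nu>\<close>
    roots remain for a polynomial of smaller degree.\<close>
  have "r (k mod \<mu>) (k div \<mu>) = 0" if "k < \<mu> * \<nu>" for k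
  proof (rule polyfun_coeffs_zero[where A = "A - {s}" and N = "\<mu> * \<nu>"
      and c = "\<lambda>k. r (k mod \<mu>) (k div \<mu>)" and i = k])
    show "\<mu> * \<nu> \<le> card (A - {s})" using A \<open>s \<in> A\<close> by simp
    fix t assume t: "t \<in> A - {s}"
    then have "t ^ \<mu> \<noteq> \<tau>"
      using A(3)[of t] A(3)[OF \<open>s \<in> A\<close>] \<open>\<mu> > 0\<close> power_eq_iff_eq_base[of \<mu> t s] by (auto simp: \<tau>_def)
    then have "(\<Sum>i<\<mu>. \<Sum>j<\<nu>. r i j * t ^ i * (t ^ \<mu>) ^ j) = 0"
      using pts[of t] t unfolding w_r by simp
    moreover have "(\<Sum>k<\<mu> * \<nu>. r (k mod \<mu>) (k div \<mu>) * t ^ k) =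
        (\<Sum>k<\<mu> * \<nu>. r (k mod \<mu>) (k div \<mu>) * t ^ (k mod \<mu>) * (t ^ \<mu>) ^ (k div \<mu>))"
      by (simp add: mult.assoc flip: power_mult power_add)
    ultimately show "(\<Sum>k<\<mu> * \<nu>. r (k mod \<mu>) (k div \<mu>) * t ^ k) = 0"
      using sum_lessThan_mult[where h = "\<lambda>i j. r i j * t ^ i * (t ^ \<mu>) ^ j" and k = \<mu> and l = \<nu>] by simp
  qed (use A that in auto)
  then have "(\<Sum>k<\<mu> * \<nu>. r (k mod \<mu>) (k div \<mu>) * x ^ (k mod \<mu>) * y ^ (k div \<mu>)) = 0" for x y by simp
  then have "(\<Sum>i<\<mu>. \<Sum>j<\<nu>. r i j * x ^ i * y ^ j) = 0" for x y
    by (metis sum_lessThan_mult[where h = "\<lambda>i j. r i j * x ^ i * y ^ j" and k = \<mu> and l = \<nu>])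
  then have zero: "(\<Sum>i\<le>\<mu>. (\<Sum>j\<le>\<nu>. w i j * y ^ j) * x ^ i) = 0" for x y
    using w_r[of x y] by (simp add: sum_distrib_left sum_distrib_right mult_ac)
  have "(\<Sum>j\<le>\<nu>. w i j * y ^ j) = 0" for y
    using polyfun_eq_0[of "\<lambda>i. \<Sum>j\<le>\<nu>. w i j * y ^ j" \<mu>] zero \<open>i \<le> \<mu>\<close> by blast
  then show ?thesis using polyfun_eq_0[of "w i" \<nu>] \<open>j \<le> \<nu>\<close> by blast
qed

section \<open>Surjectivity of the derivative and the open mapping theorem\<close>

lemma has_derivative_vec_lambda:
  fixes f :: "'a::real_normed_vector \<Rightarrow> 'i::finite \<Rightarrow> 'b::euclidean_space"
  assumes "\<And>i. ((\<lambda>x. f x i) has_derivative (\<lambda>h. f' h i)) (at x within S)"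
  shows "((\<lambda>x. \<chi> i. f x i) has_derivative (\<lambda>h. \<chi> i. f' h i)) (at x within S)"
  unfolding has_derivative_componentwise_within[of "\<lambda>x. \<chi> i. f x i"]
  by (auto simp: Basis_vec_def inner_axis intro!: has_derivative_inner_left assms)

lemma linear_range_eq_UNIV:
  fixes L :: "'a::real_vector \<Rightarrow> 'b::euclidean_space"
  assumes "linear L" "\<And>W. (\<And>z. W \<bullet> L z = 0) \<Longrightarrow> W = 0"
  shows "range L = UNIV"
proof (rule ccontr)
  assume "range L \<noteq> UNIV"
  moreover have "span (range L) = range L"
    using linear_subspace_image[OF assms(1) subspace_UNIV] by (simp add: span_eq_iff)
  ultimately have "span (range L) \<subset> span (UNIV :: 'b set)" unfolding span_UNIV by blast
  then obtain W where "W \<noteq> 0" "\<And>y. y \<in> span (range L) \<Longrightarrow> orthogonal W y"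
    using orthogonal_to_subspace_exists_gen by blast
  then show False using assms(2)[of W] by (auto simp: orthogonal_def span_base)
qed

text \<open>The tangent space to the rank-one matrices at each \<open>a k \<otimes> b k\<close>, together with the span of all
  \<open>a l \<otimes> b l\<close>, is the whole space of matrices. This makes the parametrization
  \<open>(a, b, c) \<mapsto> \<Sum>l. a l \<otimes> b l \<otimes> c l\<close> a submersion at \<open>c l = axis l 1\<close>.\<close>

definition transversal_family :: "('p::finite \<Rightarrow> real ^ 'm::finite) \<Rightarrow> ('p \<Rightarrow> real ^ 'n::finite)
    \<Rightarrow> bool" where
  "transversal_family a b \<longleftrightarrow> (\<forall>k (X :: real ^ 'n ^ 'm). \<exists>x y (g :: real ^ 'p).
     \<forall>i j. X $ i $ j = x $ i * b k $ j + a k $ i * y $ j + (\<Sum>l\<in>UNIV. g $ l * (a l $ i * b l $ j)))"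

text \<open>A matrix \<open>W\<close> orthogonal to the space in question is read as a bivariate
  polynomial, \<open>a l\<close> and \<open>b l\<close> being its monomials at the point
  \<open>(t l, t l ^ \<mu>)\<close>. Orthogonality to the tangent directions makes it vanish on the
  two axis-parallel lines through the \<open>k\<close>-th point, and orthogonality to the span makes
  it vanish at all the points. \<open>bivariate_polynomial_zero\<close> then gives
  \<open>W = 0\<close>.\<close>

lemma ex_transversal_family:
  assumes "CARD('m::finite) \<ge> 2" and p: "(CARD('m) - 1) * (CARD('n::finite) - 1) + 1 \<le> CARD('p::finite)"
  shows "\<exists>(a :: 'p \<Rightarrow> real ^ 'm) (b :: 'p \<Rightarrow> real ^ 'n). transversal_family a b"
proof -
  define \<mu> \<nu> where "\<mu> = CARD('m) - 1" and "\<nu> = CARD('n) - 1"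
  obtain f :: "'m \<Rightarrow> nat" where f: "bij_betw f UNIV {..\<mu>}"
    using ex_bij_betw_CARD[where 'a = 'm] zero_less_card_finite[where 'a = 'm]
    by (metis \<mu>_def Suc_pred lessThan_Suc_atMost One_nat_def)
  obtain g :: "'n \<Rightarrow> nat" where g: "bij_betw g UNIV {..\<nu>}"
    using ex_bij_betw_CARD[where 'a = 'n] zero_less_card_finite[where 'a = 'n]
    by (metis \<nu>_def Suc_pred lessThan_Suc_atMost One_nat_def)
  obtain e :: "'p \<Rightarrow> nat" where e: "bij_betw e UNIV {..<CARD('p)}"
    using ex_bij_betw_CARD by blast
  \<comment> \<open>The summand 1 makes the points positive, as
    \<open>bivariate_polynomial_zero\<close> requires.\<close>
  define t where "t k = real (e k) + 1" for k
  define a :: "'p \<Rightarrow> real ^ 'm" where "a l = (\<chi> i. t l ^ f i)" for l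
  define b :: "'p \<Rightarrow> real ^ 'n" where "b l = (\<chi> j. (t l ^ \<mu>) ^ g j)" for l
  have "range L = UNIV"
    if L: "L = (\<lambda>(x, y, h). \<chi> i j. x $ i * b k $ j + a k $ i * y $ j +
        (\<Sum>l\<in>UNIV. h $ l * (a l $ i * b l $ j)))"
    for k and L :: "(real ^ 'm) \<times> (real ^ 'n) \<times> (real ^ 'p) \<Rightarrow> real ^ 'n ^ 'm"
  proof (rule linear_range_eq_UNIV)
    show "linear L"
    proof (rule linearI)
      fix u v
      show "L (u + v) = L u + L v"
        by (cases u; cases v) (simp add: L vec_eq_iff distrib_left distrib_right sum.distrib)
    next
      fix r u
      show "L (r *\<^sub>R u) = r *\<^sub>R L u"
        by (cases u) (simp add: L vec_eq_iff distrib_left sum_distrib_left mult.assoc mult.left_commute)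
    qed
    fix W assume W: "\<And>z. W \<bullet> L z = 0"
    have row: "(\<Sum>i\<in>UNIV. W $ i $ j * a k $ i) = 0" for j
    proof -
      have "W \<bullet> L (0, axis j 1, 0) = (\<Sum>i\<in>UNIV. \<Sum>j'\<in>UNIV. if j' = j then W $ i $ j * a k $ i else 0)"
        unfolding inner_vec_def by (intro sum.cong) (auto simp: L axis_def)
      then show ?thesis using W by simp
    qed
    have col: "(\<Sum>j\<in>UNIV. W $ i $ j * b k $ j) = 0" for i
    proof -
      have "W \<bullet> L (axis i 1, 0, 0) = (\<Sum>i'\<in>UNIV. if i' = i then \<Sum>j\<in>UNIV. W $ i $ j * b k $ j else 0)"
        unfolding inner_vec_def by (intro sum.cong) (auto simp: L axis_def)
      then show ?thesis using W by simp
    qed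
    have pts: "(\<Sum>i\<in>UNIV. \<Sum>j\<in>UNIV. W $ i $ j * a l $ i * b l $ j) = 0" for l
    proof -
      have "(\<Sum>l'\<in>UNIV. axis l 1 $ l' * (a l' $ i * b l' $ j)) = a l $ i * b l $ j" for i j
      proof -
        have "(\<Sum>l'\<in>UNIV. axis l 1 $ l' * (a l' $ i * b l' $ j))
            = (\<Sum>l'\<in>UNIV. if l' = l then a l $ i * b l $ j else 0)"
          by (intro sum.cong) (auto simp: axis_def)
        then show ?thesis by simp
      qed
      then show ?thesis using W[of "(0, 0, axis l 1)"]
        by (simp add: L inner_vec_def mult.assoc)
    qed
    define w where "w i j = W $ inv f i $ inv g j" for i j
    have inv: "inv f (f i) = i" "inv g (g j) = j" for i j
      using f g by (auto simp: bij_betw_def)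
    have sum_f: "(\<Sum>i\<le>\<mu>. h i) = (\<Sum>i\<in>UNIV. h (f i))" for h :: "nat \<Rightarrow> real"
      by (rule sum.reindex_bij_betw[OF f, symmetric])
    have sum_g: "(\<Sum>j\<le>\<nu>. h j) = (\<Sum>j\<in>UNIV. h (g j))" for h :: "nat \<Rightarrow> real"
      by (rule sum.reindex_bij_betw[OF g, symmetric])
    have "w i j = 0" if "i \<le> \<mu>" "j \<le> \<nu>" for i j
    proof (rule bivariate_polynomial_zero[where w = w and i = i and j = j and A = "range t" and s =
        "t k" and \<mu> = \<mu> and \<nu> = \<nu>])
      have "inj t" using e by (auto simp: t_def inj_on_def bij_betw_def)
      then show "\<mu> * \<nu> + 1 \<le> card (range t)" using p by (simp add: card_image \<mu>_def \<nu>_def)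
      show "(\<Sum>i\<le>\<mu>. w i j * t k ^ i) = 0" for j
        using row unfolding sum_f by (simp add: w_def inv a_def)
      show "(\<Sum>j\<le>\<nu>. w i j * (t k ^ \<mu>) ^ j) = 0" for i
        using col unfolding sum_g by (simp add: w_def inv b_def)
      show "(\<Sum>i\<le>\<mu>. \<Sum>j\<le>\<nu>. w i j * x ^ i * (x ^ \<mu>) ^ j) = 0" if "x \<in> range t" for x
        using pts that unfolding sum_f sum_g by (auto simp: w_def inv a_def b_def)
    qed (use that assms(1) in \<open>auto simp: \<mu>_def t_def\<close>)
    moreover have "f i \<le> \<mu>" "g j \<le> \<nu>" for i j using f g by (auto simp: bij_betw_def)
    ultimately have "w (f i) (g j) = 0" for i j by blast
    then show "W = 0" by (simp add: w_def inv vec_eq_iff)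
  qed
  note surj = this
  have "\<exists>x y (h :: real ^ 'p). \<forall>i j. X $ i $ j
      = x $ i * b k $ j + a k $ i * y $ j + (\<Sum>l\<in>UNIV. h $ l * (a l $ i * b l $ j))"
    for k and X :: "real ^ 'n ^ 'm"
  proof -
    obtain z where z: "X = (\<lambda>(x, y, h). \<chi> i j. x $ i * b k $ j + a k $ i * y $ j +
        (\<Sum>l\<in>UNIV. h $ l * (a l $ i * b l $ j))) z"
      using surj[OF refl, of k] by (metis (no_types, lifting) surjD)
    obtain x y h where "z = (x, y, h)" by (cases z)
    then show ?thesis using z by (intro exI[of _ x] exI[of _ y] exI[of _ h]) simp
  qed
  then have "transversal_family a b" unfolding transversal_family_def by blast
  then show ?thesis by blast
qed

text \<open>With \<open>c l = axis l 1\<close>, slice \<open>k\<close> of the derivative involves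
  only the variations of \<open>a k\<close> and \<open>b k\<close> and the \<open>k\<close>-th
  coordinates of the variations of all \<open>c l\<close>. Hence each slice of a target can be
  solved for separately. The derivative is onto, and the open mapping theorem gives an interior
  point of the image.\<close>

lemma transversal_family_interior_decomposable:
  fixes a :: "'p::finite \<Rightarrow> real ^ 'm::finite" and b :: "'p \<Rightarrow> real ^ 'n::finite"
  assumes "transversal_family a b"
  shows "interior {T :: ('m, 'n, 'p) tensor. has_decomposition T CARD('p)} \<noteq> {}"
proof -
  define F :: "(real ^ 'm ^ 'p) \<times> (real ^ 'n ^ 'p) \<times> (real ^ 'p ^ 'p) \<Rightarrow> ('m, 'n, 'p) tensor"
    where "F z = (\<chi> i j k. \<Sum>l\<in>UNIV. fst z $ l $ i * fst (snd z) $ l $ j * snd (snd z) $ l $ k)" for z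
  define c :: "real ^ 'p ^ 'p" where "c = (\<chi> l. axis l 1)"
  define z where "z = ((\<chi> l. a l) :: real ^ 'm ^ 'p, (\<chi> l. b l) :: real ^ 'n ^ 'p, c)"
  define F' :: "(real ^ 'm ^ 'p) \<times> (real ^ 'n ^ 'p) \<times> (real ^ 'p ^ 'p) \<Rightarrow> ('m, 'n, 'p) tensor"
    where "F' h = (\<chi> i j k. \<Sum>l\<in>UNIV. fst h $ l $ i * b l $ j * c $ l $ k
      + a l $ i * fst (snd h) $ l $ j * c $ l $ k + a l $ i * b l $ j * snd (snd h) $ l $ k)" for h
  have deriv: "(F has_derivative F') (at z)"
    unfolding F_def F'_def
  proof (intro has_derivative_vec_lambda has_derivative_sum)
    fix i j k l
    have d1: "((\<lambda>z :: (real ^ 'm ^ 'p) \<times> (real ^ 'n ^ 'p) \<times> (real ^ 'p ^ 'p). fst z $ l $ i)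
        has_derivative (\<lambda>h. fst h $ l $ i)) (at z)"
      by (intro linear_imp_has_derivative linearI) simp_all
    have d2: "((\<lambda>z :: (real ^ 'm ^ 'p) \<times> (real ^ 'n ^ 'p) \<times> (real ^ 'p ^ 'p). fst (snd z) $ l $ j)
        has_derivative (\<lambda>h. fst (snd h) $ l $ j)) (at z)"
      by (intro linear_imp_has_derivative linearI) simp_all
    have d3: "((\<lambda>z :: (real ^ 'm ^ 'p) \<times> (real ^ 'n ^ 'p) \<times> (real ^ 'p ^ 'p). snd (snd z) $ l $ k)
        has_derivative (\<lambda>h. snd (snd h) $ l $ k)) (at z)"
      by (intro linear_imp_has_derivative linearI) simp_all
    show "((\<lambda>z. fst z $ l $ i * fst (snd z) $ l $ j * snd (snd z) $ l $ k) has_derivative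
        (\<lambda>h. fst h $ l $ i * b l $ j * c $ l $ k + a l $ i * fst (snd h) $ l $ j * c $ l $ k
          + a l $ i * b l $ j * snd (snd h) $ l $ k)) (at z)"
      by (rule has_derivative_eq_rhs[OF has_derivative_mult[OF has_derivative_mult[OF d1 d2] d3]])
        (simp add: z_def fun_eq_iff algebra_simps)
  qed
  have "range F' = UNIV"
  proof (intro equalityI subset_UNIV subsetI)
    fix Y :: "('m, 'n, 'p) tensor"
    have "\<forall>k. \<exists>(x :: real ^ 'm) (y :: real ^ 'n) (g :: real ^ 'p). \<forall>i j. Y $ i $ j $ k
        = x $ i * b k $ j + a k $ i * y $ j + (\<Sum>l\<in>UNIV. g $ l * (a l $ i * b l $ j))"
    proof
      fix k
      show "\<exists>(x :: real ^ 'm) (y :: real ^ 'n) (g :: real ^ 'p). \<forall>i j. Y $ i $ j $ k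
          = x $ i * b k $ j + a k $ i * y $ j + (\<Sum>l\<in>UNIV. g $ l * (a l $ i * b l $ j))"
        using assms[unfolded transversal_family_def, rule_format, of "\<chi> i j. Y $ i $ j $ k" k] by simp
    qed
    then obtain x :: "'p \<Rightarrow> real ^ 'm" and y :: "'p \<Rightarrow> real ^ 'n" and g :: "'p \<Rightarrow> real ^ 'p" where
      xyg: "\<And>i j k. Y $ i $ j $ k = x k $ i * b k $ j + a k $ i * y k $ j +
          (\<Sum>l\<in>UNIV. g k $ l * (a l $ i * b l $ j))"
      unfolding choice_iff by blast
    \<comment> \<open>The coefficients for slice \<open>k\<close> become the \<open>k\<close>-th
      coordinates of the third factors, hence the exchanged indices of \<open>g\<close>.\<close>
    have "F' (\<chi> l. x l, \<chi> l. y l, \<chi> l k. g k $ l) $ i $ j $ k = Y $ i $ j $ k" for i j k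
    proof -
      have "F' (\<chi> l. x l, \<chi> l. y l, \<chi> l k. g k $ l) $ i $ j $ k =
         (\<Sum>l\<in>UNIV. (if l = k then x k $ i * b k $ j + a k $ i * y k $ j else 0) + g k $ l *
             (a l $ i * b l $ j))"
        unfolding F'_def c_def by (auto simp: axis_def intro!: sum.cong)
      then show ?thesis by (simp add: xyg sum.distrib)
    qed
    then have "F' (\<chi> l. x l, \<chi> l. y l, \<chi> l k. g k $ l) = Y" by (simp add: vec_eq_iff)
    then show "Y \<in> range F'" by blast
  qed
  moreover have "linear F'" using deriv has_derivative_linear by blast
  ultimately obtain G where G: "linear G" "F' \<circ> G = id"
    using linear_surjective_right_inverse by blast
  have "F z \<in> interior (range F)"
  proof (rule sussmann_open_mapping[OF open_UNIV _ _ deriv])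
    show "continuous_on UNIV F" unfolding F_def by (intro continuous_intros)
    show "bounded_linear G" using G(1) linear_conv_bounded_linear by blast
  qed (use G in auto)
  moreover have "range F \<subseteq> {T. has_decomposition T CARD('p)}"
  proof
    fix T assume "T \<in> range F"
    then obtain u where u: "T = F u" by blast
    obtain h :: "nat \<Rightarrow> 'p" where h: "bij_betw h {0..<CARD('p)} UNIV"
      using ex_bij_betw_nat_finite[of "UNIV :: 'p set"] by auto
    have "T = (\<Sum>l\<in>UNIV. tensor_product (fst u $ l) (fst (snd u) $ l) (snd (snd u) $ l))"
      by (simp add: u F_def vec_eq_iff sum_component tensor_product_def)
    also have "\<dots> = (\<Sum>l<CARD('p). tensor_product (fst u $ h l) (fst (snd u) $ h l) (snd (snd u) $ h l))"
      using sum.reindex_bij_betw[OF h, of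
          "\<lambda>l. tensor_product (fst u $ l) (fst (snd u) $ l) (snd (snd u) $ l)"]
      by (simp add: atLeast0LessThan)
    finally show "T \<in> {T. has_decomposition T CARD('p)}"
      unfolding mem_Collect_eq has_decomposition_def by (intro exI) assumption
  qed
  ultimately show ?thesis using interior_mono by blast
qed

section \<open>Typical ranks\<close>

lemma has_decomposition_mono:
  assumes "has_decomposition T r" "r \<le> s"
  shows "has_decomposition T s"
proof -
  obtain a b c where abc: "T = (\<Sum>l<r. tensor_product (a l) (b l) (c l))"
    using assms(1) unfolding has_decomposition_def by blast
  have "(\<Sum>l<s. tensor_product (if l < r then a l else 0) (b l) (c l)) = T"
    unfolding abc using assms(2)
    by (intro sum.mono_neutral_cong_right) (auto simp: tensor_product_def vec_eq_iff)
  then show ?thesis unfolding has_decomposition_def by metis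
qed

lemma tensor_rank_le_iff: "tensor_rank T \<le> r \<longleftrightarrow> has_decomposition T r"
  using has_decomposition_mono has_decomposition_tensor_rank Least_le unfolding tensor_rank_def by metis

lemma has_decomposition_Suc_iff:
  "has_decomposition T (Suc r) \<longleftrightarrow> (\<exists>S a b c. has_decomposition S r \<and> T = S + tensor_product a b c)"
proof
  assume "has_decomposition T (Suc r)"
  then obtain a b c where "T = (\<Sum>l<r. tensor_product (a l) (b l) (c l)) + tensor_product (a r) (b r)
      (c r)"
    unfolding has_decomposition_def by auto
  moreover have "has_decomposition (\<Sum>l<r. tensor_product (a l) (b l) (c l)) r"
    unfolding has_decomposition_def by blast
  ultimately show "\<exists>S a b c. has_decomposition S r \<and> T = S + tensor_product a b c" by blast
next
  assume "\<exists>S a b c. has_decomposition S r \<and> T = S + tensor_product a b c"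
  then obtain a b c a' b' c' where T: "T =
      (\<Sum>l<r. tensor_product (a l) (b l) (c l)) + tensor_product a' b' c'"
    unfolding has_decomposition_def by auto
  have "T = (\<Sum>l<Suc r. tensor_product ((a(r := a')) l) ((b(r := b')) l) ((c(r := c')) l))"
    unfolding T by simp
  then show "has_decomposition T (Suc r)" unfolding has_decomposition_def by blast
qed

lemma continuous_on_tensor_product:
  "continuous_on S (\<lambda>(a, b, c). tensor_product a b c)"
  unfolding tensor_product_def case_prod_beta by (intro continuous_intros)

text \<open>This is for measurability: the set itself need not be closed. Bounding the vectors of
  the last summand gives compact sets \<open>E N\<close>, and sums of compact sets are compact.
  Monotonicity brings both summands to a common level.\<close>

lemma has_decomposition_sigma_compact:
  "\<exists>C :: nat \<Rightarrow> ('m::finite, 'n::finite, 'p::finite) tensor set.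
     (\<forall>N. compact (C N)) \<and> incseq C \<and> {T. has_decomposition T r} = (\<Union>N. C N)"
proof (induction r)
  case 0
  have "{T :: ('m, 'n, 'p) tensor. has_decomposition T 0} = {0}" by (auto simp: has_decomposition_def)
  then show ?case by (intro exI[of _ "\<lambda>_. {0}"]) (auto simp: incseq_def)
next
  case (Suc r)
  obtain C :: "nat \<Rightarrow> ('m, 'n, 'p) tensor set" where C:
      "\<And>N. compact (C N)" "incseq C" "{T. has_decomposition T r} = (\<Union>N. C N)"
    using Suc.IH by blast
  let ?P = "\<lambda>(a, b, c). tensor_product a b c :: ('m, 'n, 'p) tensor"
  define E where "E N = ?P ` cball 0 (real N)" for N
  define D where "D N = (\<Union>S\<in>C N. \<Union>R\<in>E N. {S + R})" for N
  have "compact (E N)" for N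
    unfolding E_def by (intro compact_continuous_image continuous_on_tensor_product) auto
  then have "compact (D N)" for N
    unfolding D_def using C(1) by (intro compact_sums')
  moreover have incE: "E M \<subseteq> E N" if "M \<le> N" for M N
    unfolding E_def using that by (intro image_mono subset_cball) auto
  then have "incseq D" using C(2) unfolding D_def incseq_def by blast
  moreover have "{T. has_decomposition T (Suc r)} = (\<Union>N. D N)"
  proof (intro equalityI subsetI)
    fix T :: "('m, 'n, 'p) tensor" assume "T \<in> {T. has_decomposition T (Suc r)}"
    then obtain S a b c where T: "has_decomposition S r" "T = S + ?P (a, b, c)"
      unfolding mem_Collect_eq has_decomposition_Suc_iff by auto
    obtain M where M: "S \<in> C M" using T(1) C(3) by blast
    obtain N where N: "norm (a, b, c) \<le> real N" using real_arch_simple by blast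
    then have "?P (a, b, c) \<in> E N" unfolding E_def by (intro imageI) (simp del: norm_Pair)
    then have "?P (a, b, c) \<in> E (max M N)" "S \<in> C (max M N)"
      using M incseqD[OF C(2), of M "max M N"] incE[of N "max M N"] by auto
    then have "T \<in> D (max M N)" unfolding D_def T(2) by blast
    then show "T \<in> (\<Union>N. D N)" by blast
  next
    fix T assume "T \<in> (\<Union>N. D N)"
    then obtain S a b c N where "S \<in> C N" "T = S + tensor_product a b c"
      unfolding D_def E_def by auto
    moreover from this(1) have "has_decomposition S r" using C(3) by blast
    ultimately show "T \<in> {T. has_decomposition T (Suc r)}"
      unfolding mem_Collect_eq has_decomposition_Suc_iff by blast
  qed
  ultimately show ?case by blast
qed

text \<open>The countably many sets \<open>S r\<close> are measurable, as differences of
  sigma-compact sets met with \<open>U\<close>, and they cover \<open>U\<close>. As a nonempty open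
  set is not negligible, one of them has positive measure.\<close>

lemma typical_rank_of_open:
  fixes U :: "('m::finite, 'n::finite, 'p::finite) tensor set"
  assumes "open U" "U \<noteq> {}"
  shows "\<exists>T\<in>U. typical_rank TYPE('m) TYPE('n) TYPE('p) (tensor_rank T)"
proof -
  have meas: "{T :: ('m, 'n, 'p) tensor. tensor_rank T \<le> r} \<in> sets borel" for r
  proof -
    obtain C :: "nat \<Rightarrow> ('m, 'n, 'p) tensor set" where
        "\<And>N. compact (C N)" "{T. has_decomposition T r} = (\<Union>N. C N)"
      using has_decomposition_sigma_compact by blast
    then show ?thesis unfolding tensor_rank_le_iff by (auto intro: borel_compact)
  qed
  define S where "S r = U \<inter> {T. tensor_rank T = r}" for r
  have "{T :: ('m, 'n, 'p) tensor. tensor_rank T = r} \<in> sets borel" for r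
  proof (cases r)
    case 0
    then show ?thesis using meas[of 0] by simp
  next
    case (Suc q)
    then have "{T :: ('m, 'n, 'p) tensor. tensor_rank T = r}
        = {T. tensor_rank T \<le> r} - {T. tensor_rank T \<le> q}" by auto
    then show ?thesis using meas by simp
  qed
  then have S: "S r \<in> sets lebesgue" for r
    unfolding S_def using assms(1) by (intro sets.Int) auto
  have "\<exists>r. emeasure lebesgue (S r) > 0"
  proof (rule ccontr)
    assume "\<not> ?thesis"
    then have "S r \<in> null_sets lebesgue" for r using S
        by (auto simp: null_sets_def zero_less_iff_neq_zero)
    then have "(\<Union>r. S r) \<in> null_sets lebesgue" by (rule null_sets_UN)
    moreover have "(\<Union>r. S r) = U" by (auto simp: S_def)
    ultimately have "negligible U" by (simp add: negligible_iff_null_sets)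
    then show False using open_not_negligible assms by blast
  qed
  then obtain r where r: "emeasure lebesgue (S r) > 0" by blast
  then have "typical_rank TYPE('m) TYPE('n) TYPE('p) r"
    unfolding typical_rank_def using S by (intro exI[of _ "S r"]) (auto simp: S_def)
  moreover have "S r \<noteq> {}" using r by auto
  ultimately show ?thesis by (auto simp: S_def)
qed

lemma two_typical_ranks:
  assumes "CARD('m::finite) \<ge> 2"
    and "(CARD('m) - 1) * (CARD('n::finite) - 1) + 1 \<le> CARD('p::finite)"
    and "nonsingular_pairing CARD('m) CARD('n) u" "CARD('p) + u \<le> CARD('m) * CARD('n)"
  shows "\<exists>r s. r \<noteq> s \<and> typical_rank TYPE('m) TYPE('n) TYPE('p) r
                   \<and> typical_rank TYPE('m) TYPE('n) TYPE('p) s"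
proof -
  let ?L = "interior {T :: ('m, 'n, 'p) tensor. has_decomposition T CARD('p)}"
  let ?U = "{T :: ('m, 'n, 'p) tensor. avoids_rank_one T}"
  have "?L \<noteq> {}"
    using ex_transversal_family[OF assms(1,2)] transversal_family_interior_decomposable by blast
  then obtain T where T: "T \<in> ?L" "typical_rank TYPE('m) TYPE('n) TYPE('p) (tensor_rank T)"
    using typical_rank_of_open[of ?L] by auto
  have "?U \<noteq> {}" using ex_avoids_rank_one[OF assms(3,4)] by blast
  then obtain S where S: "S \<in> ?U" "typical_rank TYPE('m) TYPE('n) TYPE('p) (tensor_rank S)"
    using typical_rank_of_open[OF open_avoids_rank_one] by blast
  have "tensor_rank T \<le> CARD('p)"
    using T(1) interior_subset unfolding tensor_rank_le_iff by blast
  moreover have "\<not> tensor_rank S \<le> CARD('p)"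
    using S(1) avoids_rank_one_not_has_decomposition unfolding tensor_rank_le_iff by blast
  ultimately show ?thesis using T(2) S(2) by metis
qed

section \<open>The five cases\<close>

lemma hurwitz_radon_pairing_self:
  assumes "n > 0"
  shows "nonsingular_pairing (hurwitz_radon n) n n"
proof -
  obtain q where q: "n = 2 ^ multiplicity 2 n * q" "\<not> 2 dvd q"
    using multiplicity_decompose'[of n 2] assms by auto
  define b c where "b = multiplicity 2 n mod 4" and "c = multiplicity 2 n div 4"
  obtain a where a: "q = 2 * a + 1" using q(2) by (auto elim: oddE)
  have n: "n = (2 * a + 1) * 2 ^ (b + 4 * c)"
    using q(1) unfolding a b_def c_def by (simp add: mult.commute)
  have "b < 4" by (simp add: b_def)
  then have "hurwitz_radon n = 8 * c + 2 ^ b" using n hurwitz_radon_eq by simp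
  then show ?thesis using hurwitz_radon_pairing[of b c "2 * a + 1"] n \<open>b < 4\<close> by simp
qed

theorem theorem1p1:
  fixes m n p :: nat
  assumes "m = CARD('m::finite)" and "n = CARD('n::finite)" and "p = CARD('p::finite)"
    and "(3 \<le> m \<and> m \<le> hurwitz_radon n \<and> (m - 1) * (n - 1) + 1 \<le> p \<and> p \<le> (m - 1) * n)
       \<or> (m = 3 \<and> n mod 4 = 3 \<and> p = 2 * n - 1)
       \<or> (m = 4 \<and> n mod 4 = 2 \<and> n \<ge> 6 \<and> p = 3 * n - 2)
       \<or> (m = 6 \<and> n mod 8 = 4 \<and> n \<ge> 12 \<and> p = 5 * n - 4)
       \<or> (m = 10 \<and> n mod 32 = 24 \<and> p = 9 * n - 8)"
  shows "\<exists>r s. r \<noteq> s \<and> typical_rank TYPE('m) TYPE('n) TYPE('p) r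
                   \<and> typical_rank TYPE('m) TYPE('n) TYPE('p) s"
proof -
  have "n > 0" using assms(2) by simp
  \<comment> \<open>The choices of \<open>u\<close> are \<open>n\<close>, \<open>n + 1\<close>,
    \<open>n + 2\<close>, \<open>n + 4\<close> and \<open>n + 8\<close>. In the last four cases
    \<open>p\<close> equals the lower bound \<open>(m - 1) * (n - 1) + 1\<close>, and
    \<open>u = m * n - p\<close> is divisible by 4, 4, 8 and 32, which provides families of 4, 4, 8
    and 10 matrices.\<close>
  have "m \<ge> 2 \<and> (m - 1) * (n - 1) + 1 \<le> p \<and> (\<exists>u. nonsingular_pairing m n u \<and> p + u \<le> m * n)"
    using assms(4)
  proof (elim disjE)
    assume h: "3 \<le> m \<and> m \<le> hurwitz_radon n \<and> (m - 1) * (n - 1) + 1 \<le> p \<and> p \<le> (m - 1) * n"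
    then have "nonsingular_pairing m n n"
      using nonsingular_pairing_mono[OF hurwitz_radon_pairing_self[OF \<open>n > 0\<close>]] by blast
    moreover have "p + n \<le> m * n" using h by (cases m) auto
    ultimately show ?thesis using h by auto
  next
    assume h: "m = 3 \<and> n mod 4 = 3 \<and> p = 2 * n - 1"
    then have "n + 1 = (n + 1) div 4 * 2 ^ (2 + 4 * 0)" by simp presburger
    then have "nonsingular_pairing m n (n + 1)"
      using nonsingular_pairing_mono[OF hurwitz_radon_pairing[of 2 0 "(n + 1) div 4"], of m n
          "n + 1"] h by simp
    then show ?thesis using h \<open>n > 0\<close> by (intro conjI exI[of _ "n + 1"]) auto
  next
    assume h: "m = 4 \<and> n mod 4 = 2 \<and> n \<ge> 6 \<and> p = 3 * n - 2"
    then have "n + 2 = (n + 2) div 4 * 2 ^ (2 + 4 * 0)" by simp presburger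
    then have "nonsingular_pairing m n (n + 2)"
      using nonsingular_pairing_mono[OF hurwitz_radon_pairing[of 2 0 "(n + 2) div 4"], of m n
          "n + 2"] h by simp
    then show ?thesis using h by (intro conjI exI[of _ "n + 2"]) auto
  next
    assume h: "m = 6 \<and> n mod 8 = 4 \<and> n \<ge> 12 \<and> p = 5 * n - 4"
    then have "n + 4 = (n + 4) div 8 * 2 ^ (3 + 4 * 0)" by simp presburger
    then have "nonsingular_pairing m n (n + 4)"
      using nonsingular_pairing_mono[OF hurwitz_radon_pairing[of 3 0 "(n + 4) div 8"], of m n
          "n + 4"] h by simp
    then show ?thesis using h by (intro conjI exI[of _ "n + 4"]) auto
  next
    assume h: "m = 10 \<and> n mod 32 = 24 \<and> p = 9 * n - 8"
    \<comment> \<open>Here 32 is \<open>2 ^ (b + 4 * c)\<close> with \<open>b = c = 1\<close>, which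
      gives \<open>8 * 1 + 2 ^ 1 = 10\<close> matrices.\<close>
    then have "n + 8 = (n + 8) div 32 * 2 ^ (1 + 4 * 1)" by simp presburger
    then have "nonsingular_pairing m n (n + 8)"
      using nonsingular_pairing_mono[OF hurwitz_radon_pairing[of 1 1 "(n + 8) div 32"], of m n
          "n + 8"] h by simp
    \<comment> \<open>This keeps the natural-number difference \<open>9 * n - 8\<close> from being
      truncated.\<close>
    moreover have "n \<ge> 24" using h mod_less_eq_dividend[of n 32] by simp
    ultimately show ?thesis using h by (intro conjI exI[of _ "n + 8"]) auto
  qed
  then show ?thesis using two_typical_ranks[where 'm = 'm and 'n = 'n and 'p = 'p]
    unfolding assms(1-3) by blast
qed

end
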